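(* Let $n \geq 1$ and let $I = \{0\} \cup I_+ \cup I_-$ be a disjoint union with $|I_+| = |I_-| = n$, so that $|I| = 2n+1$. Let $Games(I)$ denote the set of all games on $I$ and let $Games(I_+,I_-)$ denote the set of games $\Pi$ on $I$ with $\Pi(0) = I_-$ and $\Pi^{-1}(0) = I_+$. Then $$|Games(I)| \ = \ \binom{2n}{n} \cdot |Games(I_+,I_-)| \ \geq \ \binom{2n}{n} \cdot 2^{n(n-1)}.$$
   Context: A digraph on a finite set $I$ is a relation $\Pi \subset I \times I$ with $\Pi \cap \Pi^{-1} = \emptyset$ (in particular no loops), where $\Pi^{-1} = \{(j,i) : (i,j) \in \Pi\}$. For $i \in I$, $\Pi(i) = \{j : (i,j) \in \Pi\}$ is the set of outputs and $\Pi^{-1}(i) = \{j : (j,i)\in \Pi\}$ the set of inputs. A tournament on $I$ is a digraph such that for every pair of distinct $i,j$ exactly one of $(i,j),(j,i)$ lies in $\Pi$. A game on $I$ is a regular tournament: $|I|=2n+1$ is odd and $|\Pi(i)| = |\Pi^{-1}(i)| = n$ for every $i \in I$. Games are counted as subsets of $I \times I$ (labeled, not up to isomorphism). *)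

theory Defs
  imports Main
begin

definition digraph_on :: "'a set \<Rightarrow> ('a \<times> 'a) set \<Rightarrow> bool" where
  "digraph_on I \<Pi> \<longleftrightarrow> finite I \<and> \<Pi> \<subseteq> I \<times> I \<and> \<Pi> \<inter> \<Pi>\<inverse> = {}"

definition outputs :: "('a \<times> 'a) set \<Rightarrow> 'a \<Rightarrow> 'a set" where
  "outputs \<Pi> i = \<Pi> `` {i}"

definition inputs :: "('a \<times> 'a) set \<Rightarrow> 'a \<Rightarrow> 'a set" where
  "inputs \<Pi> i = \<Pi>\<inverse> `` {i}"

definition tournament_on :: "'a set \<Rightarrow> ('a \<times> 'a) set \<Rightarrow> bool" where
  "tournament_on I \<Pi> \<longleftrightarrow> digraph_on I \<Pi> \<and>
     (\<forall>i\<in>I. \<forall>j\<in>I. i \<noteq> j \<longrightarrow> ((i, j) \<in> \<Pi> \<longleftrightarrow> (j, i) \<notin> \<Pi>))"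

definition game_on :: "'a set \<Rightarrow> ('a \<times> 'a) set \<Rightarrow> bool" where
  "game_on I \<Pi> \<longleftrightarrow> tournament_on I \<Pi> \<and>
     (\<exists>n. card I = 2 * n + 1 \<and>
          (\<forall>i\<in>I. card (outputs \<Pi> i) = n \<and> card (inputs \<Pi> i) = n))"

definition Games :: "'a set \<Rightarrow> ('a \<times> 'a) set set" where
  "Games I = {\<Pi>. game_on I \<Pi>}"

text \<open>The distinguished vertex (written 0 in the mathematics) is the parameter \<open>z\<close>.\<close>

definition Games_split :: "'a \<Rightarrow> 'a set \<Rightarrow> 'a set \<Rightarrow> ('a \<times> 'a) set set" where
  "Games_split z Ip Im =
     {\<Pi> \<in> Games ({z} \<union> Ip \<union> Im). outputs \<Pi> z = Im \<and> inputs \<Pi> z = Ip}"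

end

(*
Relabelling I_+ and I_- inside I - {0} shows that each of the (2n choose n) possible output sets
of 0 is realised by the same number of games, which gives the equality.

For the bound, any two tournaments T_+ on I_+ and T_- on I_- extend to a game with outputs I_- and
inputs I_+ at 0; there are 2^(n(n-1)/2) choices for each of them.  Among the orientations of the
edges between I_+ and I_- take one minimising the sum of (outdegree - n)^2.  If some vertex u had
outdegree > n, let R be the set of vertices reachable from u along mixed arcs, and let p, q be the
sizes of its intersections with I_+ and I_-.  No mixed arc leaves R, so the outdegrees on R - {0}
exceed n by at most ((p - q) - (p - q)^2) / 2 <= 0 in total.  Hence R contains a vertex w of outdegree < n,
and reversing a path from u to w contradicts minimality.
*)
theory Submission
  imports Defs
begin

section \<open>Elementary facts on tournaments and a lower bound for their number\<close>

lemma tournament_onD: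
  assumes "tournament_on I \<Pi>"
  shows tournament_on_finite: "finite I"
    and tournament_on_subset: "\<Pi> \<subseteq> I \<times> I"
    and tournament_on_irrefl: "(i, i) \<notin> \<Pi>"
    and tournament_on_asym: "(i, j) \<in> \<Pi> \<Longrightarrow> (j, i) \<notin> \<Pi>"
    and tournament_on_total: "i \<in> I \<Longrightarrow> j \<in> I \<Longrightarrow> i \<noteq> j \<Longrightarrow> (i, j) \<in> \<Pi> \<or> (j, i) \<in> \<Pi>"
  using assms unfolding tournament_on_def digraph_on_def by blast+

lemma tournament_onI:
  assumes "finite I" "\<Pi> \<subseteq> I \<times> I"
    and "\<And>i j. (i, j) \<in> \<Pi> \<Longrightarrow> (j, i) \<notin> \<Pi>"
    and "\<And>i j. i \<in> I \<Longrightarrow> j \<in> I \<Longrightarrow> i \<noteq> j \<Longrightarrow> (i, j) \<in> \<Pi> \<or> (j, i) \<in> \<Pi>"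
  shows "tournament_on I \<Pi>"
  using assms unfolding tournament_on_def digraph_on_def by blast

lemma finite_tournaments: "finite {\<Pi>. tournament_on I \<Pi>}"
proof (cases "finite I")
  case True
  then show ?thesis
    by (intro finite_subset[of "{\<Pi>. tournament_on I \<Pi>}" "Pow (I \<times> I)"])
       (auto dest: tournament_on_subset)
next
  case False
  then have "{\<Pi>. tournament_on I \<Pi>} = {}" using tournament_on_finite by blast
  then show ?thesis by simp
qed

lemma outputs_subset: "tournament_on I \<Pi> \<Longrightarrow> outputs \<Pi> i \<subseteq> I - {i}"
  using tournament_on_subset tournament_on_irrefl by (fastforce simp: outputs_def)

lemma finite_outputs: "tournament_on I \<Pi> \<Longrightarrow> finite (outputs \<Pi> i)"
  by (meson finite_Diff finite_subset outputs_subset tournament_on_finite)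

lemma tournament_on_restrict:
  "tournament_on I \<Pi> \<Longrightarrow> A \<subseteq> I \<Longrightarrow> tournament_on A (\<Pi> \<inter> A \<times> A)"
  by (rule tournament_onI) (auto dest: tournament_onD finite_subset)

lemma inputs_tournament:
  assumes "tournament_on I \<Pi>" "i \<in> I"
  shows "inputs \<Pi> i = I - {i} - outputs \<Pi> i"
  using tournament_onD[OF assms(1)] assms(2) unfolding inputs_def outputs_def by blast

text \<open>The arc set and its converse partition the ordered pairs of distinct vertices, and the
  outdegrees add up to the number of arcs.\<close>

lemma sum_outputs_tournament:
  assumes "tournament_on I \<Pi>"
  shows "2 * (\<Sum>i\<in>I. card (outputs \<Pi> i)) = card I * (card I - 1)"
proof -
  have fin: "finite I" and sub: "\<Pi> \<subseteq> I \<times> I"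
    using tournament_onD[OF assms] by blast+
  have fin\<Pi>: "finite \<Pi>"
    using fin sub by (meson finite_SigmaI finite_subset)
  have "\<Pi> = Sigma I (outputs \<Pi>)"
    using sub by (auto simp: outputs_def)
  then have "card \<Pi> = (\<Sum>i\<in>I. card (outputs \<Pi> i))"
    using card_SigmaI[OF fin] finite_outputs[OF assms] by metis
  moreover have "\<Pi> \<union> \<Pi>\<inverse> = Sigma I (\<lambda>i. I - {i})"
    using tournament_onD[OF assms] by blast
  then have "card (\<Pi> \<union> \<Pi>\<inverse>) = (\<Sum>i\<in>I. card (I - {i}))"
    using fin by simp
  moreover have "(\<Sum>i\<in>I. card (I - {i})) = card I * (card I - 1)"
    using fin by simp
  moreover have "\<Pi> \<inter> \<Pi>\<inverse> = {}"
    using assms by (auto simp: tournament_on_def digraph_on_def)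
  then have "card (\<Pi> \<union> \<Pi>\<inverse>) = 2 * card \<Pi>"
    using fin\<Pi> by (simp add: card_Un_disjoint)
  ultimately show ?thesis by simp
qed

text \<open>Induction on the vertices: when \<open>x\<close> joins a tournament \<open>T\<close> on
  \<open>A\<close>, its output set \<open>S\<close> may be any subset of \<open>A\<close>, which
  gives a factor \<open>2 ^ card A\<close>. Both \<open>T\<close> and \<open>S\<close> can be read
  off from the enlarged tournament, so distinct choices stay distinct.\<close>

lemma card_tournaments_ge:
  fixes A :: "'a set"
  assumes "finite A"
  shows "2 ^ (card A choose 2) \<le> card {T. tournament_on A T}"
  using assms
proof (induction A)
  case empty
  have "{T :: ('a \<times> 'a) set. tournament_on {} T} = {{}}"
    by (auto intro: tournament_onI dest: tournament_on_subset)
  then show ?case by (simp add: numeral_2_eq_2)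
next
  case (insert x A)
  define f where "f = (\<lambda>(T :: ('a \<times> 'a) set, S). T \<union> {x} \<times> S \<union> (A - S) \<times> {x})"
  let ?D = "{T. tournament_on A T} \<times> Pow A"
  have "inj_on f ?D"
  proof (rule inj_onI)
    fix p q assume p: "p \<in> ?D" and q: "q \<in> ?D" and eq: "f p = f q"
    obtain T S T' S' where pq: "p = (T, S)" "q = (T', S')" by fastforce
    have T: "T \<subseteq> A \<times> A" "T' \<subseteq> A \<times> A" "S \<subseteq> A" "S' \<subseteq> A"
      using p q pq by (auto dest: tournament_on_subset)
    have "T = f p \<inter> A \<times> A" "T' = f q \<inter> A \<times> A" "S = f p `` {x}" "S' = f q `` {x}"
      using T insert.hyps by (auto simp: f_def pq)
    then have "T = T'" "S = S'" using eq by metis+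
    then show "p = q" using pq by simp
  qed
  moreover have "tournament_on (insert x A) (f (T, S))" if T: "tournament_on A T" and "S \<subseteq> A" for T S
  proof (rule tournament_onI)
    show "finite (insert x A)" using insert.hyps by simp
    show "f (T, S) \<subseteq> insert x A \<times> insert x A"
      using tournament_on_subset[OF T] \<open>S \<subseteq> A\<close> by (auto simp: f_def)
    show "(j, i) \<notin> f (T, S)" if "(i, j) \<in> f (T, S)" for i j
      using that tournament_on_subset[OF T] tournament_on_asym[OF T] \<open>S \<subseteq> A\<close> insert.hyps
      by (auto simp: f_def)
    show "(i, j) \<in> f (T, S) \<or> (j, i) \<in> f (T, S)"
      if "i \<in> insert x A" "j \<in> insert x A" "i \<noteq> j" for i j
      using that tournament_on_total[OF T, of i j] by (auto simp: f_def)
  qed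
  then have "f ` ?D \<subseteq> {T. tournament_on (insert x A) T}" by auto
  ultimately have "card ?D \<le> card {T. tournament_on (insert x A) T}"
    by (intro card_inj_on_le[of f] finite_tournaments)
  moreover have "2 ^ (card (insert x A) choose 2) = 2 ^ (card A choose 2) * (2::nat) ^ card A"
    using insert.hyps by (simp add: numeral_2_eq_2 power_add)
  moreover have "2 ^ (card A choose 2) * 2 ^ card A \<le> card ?D"
    unfolding card_cartesian_product card_Pow[OF insert.hyps(1)]
    by (rule mult_le_mono1[OF insert.IH])
  ultimately show ?case by linarith
qed

section \<open>Reversing paths to balance outdegrees\<close>

lemma rtrancl_distinct_path:
  assumes "(u, w) \<in> R\<^sup>*"
  shows "\<exists>xs. distinct (u # xs) \<and> successively (\<lambda>x y. (x, y) \<in> R) (u # xs) \<and> last (u # xs) = w"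
  using assms
proof (induction rule: converse_rtrancl_induct)
  case base
  then show ?case by (intro exI[of _ "[]"]) simp
next
  case (step u v)
  then obtain xs where xs: "distinct (v # xs)" "successively (\<lambda>x y. (x, y) \<in> R) (v # xs)"
      "last (v # xs) = w" by blast
  show ?case
  proof (cases "u \<in> set (v # xs)")
    case True
    then obtain ys zs where split: "v # xs = ys @ u # zs" by (meson split_list)
    \<comment> \<open>If \<open>u\<close> recurs on the path from \<open>v\<close>, the detour up to
      that occurrence is cut out and only the tail after it is kept.\<close>
    show ?thesis
      using xs unfolding split
      by (intro exI[of _ zs]) (auto simp: successively_append_iff)
  next
    case False
    then show ?thesis using xs step by (intro exI[of _ "v # xs"]) auto
  qed
qed

text \<open>The symmetric relation \<open>B\<close> marks the pairs whose orientation is free.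
  Reversing the first arc moves one unit of outdegree from \<open>u\<close> to the next vertex;
  induction carries this unit on to the end of the path, and the intermediate changes cancel.
  Differences are taken in the integers to avoid truncated subtraction.\<close>

lemma reverse_path:
  fixes \<Pi> :: "('a \<times> 'a) set"
  assumes "tournament_on I \<Pi>" "sym B"
    and "distinct (u # xs)" "successively (\<lambda>x y. (x, y) \<in> \<Pi> \<inter> B) (u # xs)"
  shows "\<exists>\<Pi>'. tournament_on I \<Pi>' \<and> \<Pi>' - B = \<Pi> - B \<and>
    (\<forall>i. int (card (outputs \<Pi>' i)) =
       int (card (outputs \<Pi> i)) - of_bool (i = u) + of_bool (i = last (u # xs)))"
  using assms
proof (induction xs arbitrary: u \<Pi>)
  case Nil
  then show ?case by (intro exI[of _ \<Pi>]) simp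
next
  case (Cons v xs)
  define \<Pi>1 where "\<Pi>1 = insert (v, u) (\<Pi> - {(u, v)})"
  have uv: "(u, v) \<in> \<Pi>" "(u, v) \<in> B" "(v, u) \<in> B" "u \<noteq> v"
    using Cons.prems by (auto dest: symD)
  have vu: "(v, u) \<notin> \<Pi>"
    using uv tournament_on_asym[OF Cons.prems(1)] by blast
  have t1: "tournament_on I \<Pi>1"
  proof (rule tournament_onI)
    show "finite I" using tournament_on_finite[OF Cons.prems(1)] .
    show "\<Pi>1 \<subseteq> I \<times> I"
      using tournament_on_subset[OF Cons.prems(1)] uv by (auto simp: \<Pi>1_def)
    show "(j, i) \<notin> \<Pi>1" if "(i, j) \<in> \<Pi>1" for i j
      using that tournament_on_asym[OF Cons.prems(1), of i j] uv vu by (auto simp: \<Pi>1_def)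
    show "(i, j) \<in> \<Pi>1 \<or> (j, i) \<in> \<Pi>1" if "i \<in> I" "j \<in> I" "i \<noteq> j" for i j
      using tournament_on_total[OF Cons.prems(1) that] by (auto simp: \<Pi>1_def)
  qed
  have "successively (\<lambda>x y. (x, y) \<in> \<Pi> \<inter> B) (v # xs)"
    using Cons.prems by simp
  \<comment> \<open>Here distinctness matters: \<open>u\<close> does not occur on the rest of the
    path, so removing the arc \<open>(u, v)\<close> leaves that rest intact.\<close>
  then have "successively (\<lambda>x y. (x, y) \<in> \<Pi>1 \<inter> B) (v # xs)"
    by (rule successively_mono) (use Cons.prems(3) in \<open>auto simp: \<Pi>1_def\<close>)
  moreover have "distinct (v # xs)" using Cons.prems(3) by simp
  ultimately obtain \<Pi>' where \<Pi>': "tournament_on I \<Pi>'" "\<Pi>' - B = \<Pi>1 - B"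
    "\<forall>i. int (card (outputs \<Pi>' i)) =
       int (card (outputs \<Pi>1 i)) - of_bool (i = v) + of_bool (i = last (v # xs))"
    using Cons.IH[OF t1 Cons.prems(2)] by blast
  have fin: "finite (outputs \<Pi> i)" for i
    using finite_outputs[OF Cons.prems(1)] .
  have out: "outputs \<Pi>1 i = (if i = u then outputs \<Pi> u - {v}
      else if i = v then insert u (outputs \<Pi> v) else outputs \<Pi> i)" for i
    using uv by (auto simp: outputs_def \<Pi>1_def)
  have v: "v \<in> outputs \<Pi> u" "u \<notin> outputs \<Pi> v"
    using uv vu by (auto simp: outputs_def)
  have "card (outputs \<Pi> u) = Suc (card (outputs \<Pi> u - {v}))"
    using card.remove[OF fin v(1)] .
  then have "int (card (outputs \<Pi>1 i)) = int (card (outputs \<Pi> i)) - of_bool (i = u) + of_bool (i = v)" for i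
    using uv v fin by (auto simp: out)
  moreover have "\<Pi>1 - B = \<Pi> - B"
    using uv by (auto simp: \<Pi>1_def)
  ultimately show ?case
    using \<Pi>' by (intro exI[of _ \<Pi>']) auto
qed

text \<open>This isolates the minimisation argument from the shape of \<open>B\<close>. The cut
  condition \<open>bound\<close> rules out that a set which no free arc leaves has average outdegree
  above \<open>n\<close>; it ranges over all reorientations of \<open>V\<close> along
  \<open>B\<close> because the minimiser is not known beforehand.\<close>

lemma regular_tournament_exists:
  fixes V B :: "('a \<times> 'a) set"
  assumes V: "tournament_on I V" and B: "sym B" and card: "card I = 2 * n + 1"
    and bound: "\<And>\<Pi> R. tournament_on I \<Pi> \<Longrightarrow> \<Pi> - B = V - B \<Longrightarrow> R \<subseteq> I \<Longrightarrow>
      \<Pi> \<inter> B \<inter> R \<times> (I - R) = {} \<Longrightarrow> (\<Sum>i\<in>R. card (outputs \<Pi> i)) \<le> n * card R"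
  shows "\<exists>\<Pi>. tournament_on I \<Pi> \<and> \<Pi> - B = V - B \<and> (\<forall>i\<in>I. card (outputs \<Pi> i) = n)"
proof -
  define C where "C \<Pi> \<longleftrightarrow> tournament_on I \<Pi> \<and> \<Pi> - B = V - B" for \<Pi>
  define d where "d \<Pi> i = int (card (outputs \<Pi> i)) - int n" for \<Pi> :: "('a \<times> 'a) set" and i
  \<comment> \<open>The sum of squares is nonnegative, so \<open>nat\<close> loses nothing and makes
    the minimum available by well-ordering.\<close>
  define f where "f \<Pi> = nat (\<Sum>i\<in>I. (d \<Pi> i)\<^sup>2)" for \<Pi>
  have "C V" using V by (simp add: C_def)
  then obtain \<Pi> where \<Pi>: "C \<Pi>" and least: "\<And>\<Pi>'. C \<Pi>' \<Longrightarrow> f \<Pi> \<le> f \<Pi>'"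
    using ex_has_least_nat[of C V f] by blast
  have t: "tournament_on I \<Pi>" and eq: "\<Pi> - B = V - B" using \<Pi> by (auto simp: C_def)
  have fin: "finite I" and sub: "\<Pi> \<subseteq> I \<times> I" using tournament_onD[OF t] by blast+
  have "(\<Sum>i\<in>I. card (outputs \<Pi> i)) = card I * n"
    using sum_outputs_tournament[OF t] card by simp
  then have "int (\<Sum>i\<in>I. card (outputs \<Pi> i)) = int (card I * n)"
    by (rule arg_cong)
  then have sum0: "(\<Sum>i\<in>I. d \<Pi> i) = 0"
    by (simp add: d_def sum_subtractf)
  have no_excess: "d \<Pi> u \<le> 0" if u: "u \<in> I" for u
  proof (rule ccontr)
    assume "\<not> d \<Pi> u \<le> 0"
    define R where "R = (\<Pi> \<inter> B)\<^sup>* `` {u}"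
    have "R \<subseteq> I"
    proof
      fix w assume "w \<in> R"
      then have "(u, w) \<in> (\<Pi> \<inter> B)\<^sup>*" by (simp add: R_def)
      then show "w \<in> I" using u sub by (induction) auto
    qed
    moreover have "\<Pi> \<inter> B \<inter> R \<times> (I - R) = {}"
      by (auto simp: R_def intro: rtrancl_into_rtrancl)
    ultimately have "(\<Sum>i\<in>R. card (outputs \<Pi> i)) \<le> n * card R"
      using bound t eq by blast
    then have "int (\<Sum>i\<in>R. card (outputs \<Pi> i)) \<le> int (n * card R)"
      by (simp only: of_nat_le_iff)
    then have le: "(\<Sum>i\<in>R. d \<Pi> i) \<le> 0"
      by (simp add: d_def sum_subtractf mult.commute)
    have finR: "finite R" using \<open>R \<subseteq> I\<close> fin finite_subset by blast
    have uR: "u \<in> R" by (simp add: R_def)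
    have "\<exists>w\<in>R. d \<Pi> w < 0"
    proof (rule ccontr)
      assume "\<not> (\<exists>w\<in>R. d \<Pi> w < 0)"
      then have "d \<Pi> u \<le> (\<Sum>i\<in>R. d \<Pi> i)"
        by (intro member_le_sum[OF uR _ finR]) auto
      then show False using le \<open>\<not> d \<Pi> u \<le> 0\<close> by simp
    qed
    then obtain w where w: "w \<in> R" "d \<Pi> w < 0" by blast
    then have "(u, w) \<in> (\<Pi> \<inter> B)\<^sup>*" by (simp add: R_def)
    from rtrancl_distinct_path[OF this] obtain xs where
      "distinct (u # xs)" "successively (\<lambda>x y. (x, y) \<in> \<Pi> \<inter> B) (u # xs)" "last (u # xs) = w"
      by blast
    with reverse_path[OF t B] obtain \<Pi>' where \<Pi>': "tournament_on I \<Pi>'" "\<Pi>' - B = \<Pi> - B"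
      "\<forall>i. int (card (outputs \<Pi>' i)) =
         int (card (outputs \<Pi> i)) - of_bool (i = u) + of_bool (i = w)"
      by metis
    have d': "d \<Pi>' i = d \<Pi> i - of_bool (i = u) + of_bool (i = w)" for i
      using \<Pi>'(3) by (simp add: d_def)
    have "u \<noteq> w" using w \<open>\<not> d \<Pi> u \<le> 0\<close> by auto
    have wI: "w \<in> I" using w \<open>R \<subseteq> I\<close> by blast
    \<comment> \<open>The deviation at \<open>u\<close> is at least 1 and drops by one, the one at
      \<open>w\<close> is at most -1 and rises by one, and all others stay. Both squares get
      strictly smaller; the one at \<open>u\<close> serves as the witness.\<close>
    have "(\<Sum>i\<in>I. (d \<Pi>' i)\<^sup>2) < (\<Sum>i\<in>I. (d \<Pi> i)\<^sup>2)"
    proof (rule sum_strict_mono_ex1[OF fin])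
      show "\<forall>i\<in>I. (d \<Pi>' i)\<^sup>2 \<le> (d \<Pi> i)\<^sup>2"
        using w \<open>\<not> d \<Pi> u \<le> 0\<close> \<open>u \<noteq> w\<close> by (auto simp: d' abs_le_square_iff[symmetric])
      show "\<exists>i\<in>I. (d \<Pi>' i)\<^sup>2 < (d \<Pi> i)\<^sup>2"
        using w \<open>\<not> d \<Pi> u \<le> 0\<close> \<open>u \<noteq> w\<close> u
        by (intro bexI[of _ u]) (auto simp: d' power2_eq_square algebra_simps)
    qed
    moreover have "0 \<le> (\<Sum>i\<in>I. (d \<Pi>' i)\<^sup>2)" by (simp add: sum_nonneg)
    ultimately have "f \<Pi>' < f \<Pi>" by (simp add: f_def)
    moreover have "C \<Pi>'" using \<Pi>' eq by (simp add: C_def)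
    ultimately show False using least by fastforce
  qed
  \<comment> \<open>Deviations that are all nonpositive and add up to zero must vanish.\<close>
  have "\<forall>i\<in>I. - d \<Pi> i = 0"
    using sum_nonneg_eq_0_iff[OF fin, of "\<lambda>i. - d \<Pi> i"] no_excess sum0 by (simp add: sum_negf)
  then show ?thesis using t eq by (intro exI[of _ \<Pi>]) (simp add: d_def)
qed

section \<open>Extending tournaments on the two halves to a game\<close>

lemma game_onI:
  assumes t: "tournament_on I \<Pi>" and card: "card I = 2 * n + 1"
    and out: "\<And>i. i \<in> I \<Longrightarrow> card (outputs \<Pi> i) = n"
  shows "game_on I \<Pi>"
proof -
  have "card (inputs \<Pi> i) = n" if i: "i \<in> I" for i
  proof -
    show ?thesis
      using outputs_subset[OF t, of i] inputs_tournament[OF t i] out[OF i] card i finite_outputs[OF t]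
      by (simp add: card_Diff_subset)
  qed
  then show ?thesis using assms unfolding game_on_def by blast
qed

lemma game_on_card_outputs:
  assumes "game_on I \<Pi>" "card I = 2 * n + 1" "i \<in> I"
  shows "card (outputs \<Pi> i) = n" "card (inputs \<Pi> i) = n"
  using assms unfolding game_on_def by auto

text \<open>Only the mixed pairs, collected in \<open>B\<close>, get reoriented, so the arcs at
  \<open>z\<close> and the tournaments \<open>Tp\<close> and \<open>Tm\<close> survive. The work
  lies in verifying the cut condition of \<open>regular_tournament_exists\<close>.\<close>

lemma split_game_extending:
  fixes z :: 'a
  assumes z: "z \<notin> Ip" "z \<notin> Im" "Ip \<inter> Im = {}" and cards: "card Ip = n" "card Im = n"
    and Tp: "tournament_on Ip Tp" and Tm: "tournament_on Im Tm"
  shows "\<exists>\<Pi>\<in>Games_split z Ip Im. \<Pi> \<inter> Ip \<times> Ip = Tp \<and> \<Pi> \<inter> Im \<times> Im = Tm"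
proof -
  define I where "I = {z} \<union> Ip \<union> Im"
  define B where "B = Ip \<times> Im \<union> Im \<times> Ip"
  \<comment> \<open>Sending all mixed arcs from \<open>Ip\<close> to \<open>Im\<close> is an
    arbitrary starting point; what counts is the part of \<open>V\<close> outside
    \<open>B\<close>.\<close>
  define V where "V = Tp \<union> Tm \<union> {z} \<times> Im \<union> Ip \<times> {z} \<union> Ip \<times> Im"
  have fin: "finite Ip" "finite Im" using tournament_onD[OF Tp] tournament_onD[OF Tm] by blast+
  have sub: "Tp \<subseteq> Ip \<times> Ip" "Tm \<subseteq> Im \<times> Im" using tournament_onD[OF Tp] tournament_onD[OF Tm] by blast+
  have cardI: "card I = 2 * n + 1"
    using z fin cards unfolding I_def by (simp add: card_Un_disjoint)
  have V: "tournament_on I V"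
  proof (rule tournament_onI)
    show "finite I" using fin by (simp add: I_def)
    show "V \<subseteq> I \<times> I" using sub by (auto simp: V_def I_def)
    show "(j, i) \<notin> V" if "(i, j) \<in> V" for i j
      using that sub z tournament_on_asym[OF Tp, of i j] tournament_on_asym[OF Tm, of i j]
      by (auto simp: V_def)
    show "(i, j) \<in> V \<or> (j, i) \<in> V" if "i \<in> I" "j \<in> I" "i \<noteq> j" for i j
      using that tournament_on_total[OF Tp, of i j] tournament_on_total[OF Tm, of i j]
      by (auto simp: V_def I_def)
  qed
  have VB: "V - B = Tp \<union> Tm \<union> {z} \<times> Im \<union> Ip \<times> {z}"
    using sub z by (auto simp: V_def B_def)
  have fixed: "(i, j) \<in> \<Pi> \<longleftrightarrow> (i, j) \<in> Tp \<union> Tm \<union> {z} \<times> Im \<union> Ip \<times> {z}"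
    if "\<Pi> - B = V - B" "(i, j) \<notin> B" for \<Pi> i j
    using that unfolding VB by blast
  have outz: "outputs \<Pi> z = Im" if "\<Pi> - B = V - B" for \<Pi>
    using fixed[OF that, of z] z sub by (auto simp: outputs_def B_def)
  have inz: "inputs \<Pi> z = Ip" if "\<Pi> - B = V - B" for \<Pi>
    using fixed[OF that, of _ z] z sub by (auto simp: inputs_def B_def)
  have "\<exists>\<Pi>. tournament_on I \<Pi> \<and> \<Pi> - B = V - B \<and> (\<forall>i\<in>I. card (outputs \<Pi> i) = n)"
  proof (rule regular_tournament_exists[OF V _ cardI])
    show "sym B" by (auto simp: B_def sym_def)
    fix \<Pi> R
    assume t: "tournament_on I \<Pi>" and eq: "\<Pi> - B = V - B" and R: "R \<subseteq> I"
      and closed: "\<Pi> \<inter> B \<inter> R \<times> (I - R) = {}"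
    define P Q where "P = R \<inter> Ip" and "Q = R \<inter> Im"
    define p q where "p = card P" and "q = card Q"
    let ?S = "P \<union> Q"
    let ?d = "\<lambda>i. card (outputs (\<Pi> \<inter> ?S \<times> ?S) i)"
    have finPQ: "finite P" "finite Q" using fin by (auto simp: P_def Q_def)
    have disj: "P \<inter> Q = {}" using z by (auto simp: P_def Q_def)
    have pq: "p \<le> n" "q \<le> n"
      using card_mono[OF fin(1), of P] card_mono[OF fin(2), of Q] cards
      by (simp_all add: p_def q_def P_def Q_def)
    have tS: "tournament_on ?S (\<Pi> \<inter> ?S \<times> ?S)"
      by (rule tournament_on_restrict[OF t]) (auto simp: P_def Q_def I_def)
    \<comment> \<open>Arcs from \<open>P\<close> to \<open>Im\<close> are mixed and cannot leave
      \<open>R\<close>, so they end in \<open>Q\<close>. Outside \<open>?S\<close> only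
      \<open>z\<close> and the \<open>n - p\<close> vertices of \<open>Ip - P\<close> remain as
      targets.\<close>
    have outP: "card (outputs \<Pi> i) \<le> ?d i + (n + 1 - p)" if i: "i \<in> P" for i
    proof -
      have "outputs \<Pi> i \<subseteq> outputs (\<Pi> \<inter> ?S \<times> ?S) i \<union> insert z (Ip - P)"
        using i R closed tournament_on_subset[OF t]
        by (auto simp: outputs_def P_def Q_def B_def I_def)
      then have "card (outputs \<Pi> i) \<le> card (outputs (\<Pi> \<inter> ?S \<times> ?S) i \<union> insert z (Ip - P))"
        using fin finite_outputs[OF tS] by (intro card_mono) auto
      also have "\<dots> \<le> ?d i + card (insert z (Ip - P))"
        by (rule card_Un_le)
      also have "card (insert z (Ip - P)) = n + 1 - p"
        using fin cards z pq by (simp add: p_def P_def card_Diff_subset)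
      finally show ?thesis .
    qed
    \<comment> \<open>The same count with the halves exchanged, except that the arc at
      \<open>z\<close> now points towards \<open>i\<close>. This missing 1 produces the linear term
      \<open>p - q\<close> below.\<close>
    have outQ: "card (outputs \<Pi> i) \<le> ?d i + (n - q)" if i: "i \<in> Q" for i
    proof -
      have "(i, z) \<notin> \<Pi>"
        using fixed[OF eq, of i z] i z sub by (auto simp: B_def Q_def)
      then have "outputs \<Pi> i \<subseteq> outputs (\<Pi> \<inter> ?S \<times> ?S) i \<union> (Im - Q)"
        using i R closed tournament_on_subset[OF t]
        by (auto simp: outputs_def P_def Q_def B_def I_def)
      then have "card (outputs \<Pi> i) \<le> card (outputs (\<Pi> \<inter> ?S \<times> ?S) i \<union> (Im - Q))"
        using fin finite_outputs[OF tS] by (intro card_mono) auto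
      also have "\<dots> \<le> ?d i + card (Im - Q)"
        by (rule card_Un_le)
      also have "card (Im - Q) = n - q"
        using fin cards by (simp add: q_def Q_def card_Diff_subset)
      finally show ?thesis .
    qed
    have "(\<Sum>i\<in>?S. card (outputs \<Pi> i)) = (\<Sum>i\<in>P. card (outputs \<Pi> i)) + (\<Sum>i\<in>Q. card (outputs \<Pi> i))"
      using finPQ disj by (rule sum.union_disjoint)
    also have "\<dots> \<le> (\<Sum>i\<in>P. ?d i + (n + 1 - p)) + (\<Sum>i\<in>Q. ?d i + (n - q))"
      using outP outQ by (intro add_mono sum_mono)
    also have "\<dots> = (\<Sum>i\<in>?S. ?d i) + p * (n + 1 - p) + q * (n - q)"
      unfolding sum.union_disjoint[OF finPQ disj] by (simp add: sum.distrib p_def q_def)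
    finally have sum: "(\<Sum>i\<in>?S. card (outputs \<Pi> i)) \<le> (\<Sum>i\<in>?S. ?d i) + p * (n + 1 - p) + q * (n - q)" .
    have "2 * (\<Sum>i\<in>?S. ?d i) = (p + q) * (p + q - 1)"
      using sum_outputs_tournament[OF tS] finPQ disj by (simp add: card_Un_disjoint p_def q_def)
    then have "int (2 * (\<Sum>i\<in>?S. ?d i)) = int ((p + q) * (p + q - 1))"
      by (rule arg_cong)
    \<comment> \<open>For \<open>p + q = 0\<close> the natural predecessor is truncated, but the
      factor \<open>p + q\<close> makes both sides zero.\<close>
    then have dS: "2 * int (\<Sum>i\<in>?S. ?d i) = (int p + int q) * (int p + int q - 1)"
      by (cases "p + q = 0") (auto simp: of_nat_diff)
    have "int (\<Sum>i\<in>?S. card (outputs \<Pi> i)) \<le>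
        int ((\<Sum>i\<in>?S. ?d i) + p * (n + 1 - p) + q * (n - q))"
      using sum by (simp only: of_nat_le_iff)
    also have "\<dots> = int (\<Sum>i\<in>?S. ?d i) + int p * (int n + 1 - int p) + int q * (int n - int q)"
      using pq by simp
    finally have "2 * int (\<Sum>i\<in>?S. card (outputs \<Pi> i)) \<le> (int p + int q) * (int p + int q - 1)
        + 2 * (int p * (int n + 1 - int p)) + 2 * (int q * (int n - int q))"
      using dS by linarith
    also have "\<dots> = 2 * (int n * (int p + int q)) - ((int p - int q)\<^sup>2 - (int p - int q))"
      by (simp add: power2_eq_square algebra_simps)
    \<comment> \<open>Integrality enters here: every integer is at most its square, by
      \<open>self_le_power\<close> if it is positive and by nonnegativity of squares
      otherwise.\<close>
    also have "\<dots> \<le> 2 * (int n * (int p + int q))"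
      using self_le_power[of "int p - int q" 2] zero_le_power2[of "int p - int q"] by linarith
    finally have "int (\<Sum>i\<in>?S. card (outputs \<Pi> i)) \<le> int (n * (p + q))"
      by simp
    then have S: "(\<Sum>i\<in>?S. card (outputs \<Pi> i)) \<le> n * (p + q)"
      by (simp only: of_nat_le_iff)
    \<comment> \<open>If \<open>z\<close> lies in \<open>R\<close>, it contributes exactly
      \<open>n\<close>, since its outputs are always \<open>Im\<close>; hence it does not affect the
      bound.\<close>
    have R': "R = (R \<inter> {z}) \<union> ?S" "(R \<inter> {z}) \<inter> ?S = {}"
      using R z by (auto simp: I_def P_def Q_def)
    have "(\<Sum>i\<in>R. card (outputs \<Pi> i)) =
        (\<Sum>i\<in>R \<inter> {z}. card (outputs \<Pi> i)) + (\<Sum>i\<in>?S. card (outputs \<Pi> i))"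
      by (subst R'(1), rule sum.union_disjoint) (use finPQ R' in auto)
    also have "(\<Sum>i\<in>R \<inter> {z}. card (outputs \<Pi> i)) = n * card (R \<inter> {z})"
      using outz[OF eq] cards by simp
    also have "n * card (R \<inter> {z}) + (\<Sum>i\<in>?S. card (outputs \<Pi> i)) \<le> n * (card (R \<inter> {z}) + (p + q))"
      using S by (simp add: distrib_left)
    also have "card (R \<inter> {z}) + (p + q) = card ((R \<inter> {z}) \<union> ?S)"
      using R'(2) finPQ disj by (simp add: card_Un_disjoint p_def q_def)
    also have "(R \<inter> {z}) \<union> ?S = R" using R'(1) by simp
    finally show "(\<Sum>i\<in>R. card (outputs \<Pi> i)) \<le> n * card R" .
  qed
  then obtain \<Pi> where \<Pi>: "tournament_on I \<Pi>" "\<Pi> - B = V - B" "\<forall>i\<in>I. card (outputs \<Pi> i) = n"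
    by blast
  have "game_on I \<Pi>" using \<Pi> cardI by (intro game_onI) auto
  then have "\<Pi> \<in> Games_split z Ip Im"
    using outz inz \<Pi> by (simp add: Games_split_def Games_def I_def)
  moreover have "\<Pi> \<inter> Ip \<times> Ip = Tp"
  proof -
    have "\<Pi> \<inter> Ip \<times> Ip = (\<Pi> - B) \<inter> Ip \<times> Ip" using z by (auto simp: B_def)
    also have "\<dots> = Tp" unfolding \<Pi>(2) VB using z sub by auto
    finally show ?thesis .
  qed
  moreover have "\<Pi> \<inter> Im \<times> Im = Tm"
  proof -
    have "\<Pi> \<inter> Im \<times> Im = (\<Pi> - B) \<inter> Im \<times> Im" using z by (auto simp: B_def)
    also have "\<dots> = Tm" unfolding \<Pi>(2) VB using z sub by auto
    finally show ?thesis .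
  qed
  ultimately show ?thesis by blast
qed

section \<open>The lower bound for games with a prescribed split\<close>

lemma finite_Games: "finite (Games I)"
  by (rule finite_subset[OF _ finite_tournaments[of I]]) (auto simp: Games_def game_on_def)

lemma finite_Games_split: "finite (Games_split z Ip Im)"
  by (rule finite_subset[OF _ finite_Games[of "{z} \<union> Ip \<union> Im"]]) (auto simp: Games_split_def)

text \<open>Restricting a game to both halves hits every pair of tournaments, by
  \<open>split_game_extending\<close>. The exponent is twice \<open>n choose 2\<close>.\<close>

lemma card_Games_split_ge:
  fixes z :: 'a
  assumes z: "z \<notin> Ip" "z \<notin> Im" "Ip \<inter> Im = {}" and fin: "finite Ip" "finite Im"
    and cards: "card Ip = n" "card Im = n"
  shows "2 ^ (n * (n - 1)) \<le> card (Games_split z Ip Im)"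
proof -
  let ?D = "{T. tournament_on Ip T} \<times> {T. tournament_on Im T}"
  have "?D \<subseteq> (\<lambda>\<Pi>. (\<Pi> \<inter> Ip \<times> Ip, \<Pi> \<inter> Im \<times> Im)) ` Games_split z Ip Im"
    using split_game_extending[OF z cards] by force
  then have "card ?D \<le> card (Games_split z Ip Im)"
    by (rule surj_card_le[OF finite_Games_split])
  moreover have "2 ^ (n choose 2) * 2 ^ (n choose 2) \<le> card ?D"
    using card_tournaments_ge[OF fin(1)] card_tournaments_ge[OF fin(2)] cards
    by (simp add: card_cartesian_product mult_le_mono)
  moreover have "n * (n - 1) = (n choose 2) + (n choose 2)"
    unfolding choose_two mult_2[symmetric] by (rule dvd_mult_div_cancel[symmetric]) auto
  ultimately show ?thesis by (simp add: power_add)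
qed

section \<open>Relabelling vertices and counting all games\<close>

lemma map_prod_image_iff: "inj f \<Longrightarrow> (f i, f j) \<in> map_prod f f ` \<Pi> \<longleftrightarrow> (i, j) \<in> \<Pi>"
  using inj_image_mem_iff[OF prod.inj_map[of f f], of "(i, j)" \<Pi>] by simp

lemma outputs_map_prod: "inj f \<Longrightarrow> outputs (map_prod f f ` \<Pi>) (f i) = f ` outputs \<Pi> i"
  unfolding outputs_def by (auto dest: injD)

lemma inputs_map_prod: "inj f \<Longrightarrow> inputs (map_prod f f ` \<Pi>) (f i) = f ` inputs \<Pi> i"
  unfolding inputs_def by (auto dest: injD)

lemma game_on_map_prod:
  assumes f: "inj f" and g: "game_on I \<Pi>"
  shows "game_on (f ` I) (map_prod f f ` \<Pi>)"
proof -
  note mem = map_prod_image_iff[OF f]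
  have t: "tournament_on I \<Pi>" using g by (simp add: game_on_def)
  have "tournament_on (f ` I) (map_prod f f ` \<Pi>)"
  proof (rule tournament_onI)
    show "finite (f ` I)" "map_prod f f ` \<Pi> \<subseteq> f ` I \<times> f ` I"
      using tournament_onD(1,2)[OF t] by auto
    show "(j, i) \<notin> map_prod f f ` \<Pi>" if "(i, j) \<in> map_prod f f ` \<Pi>" for i j
    proof -
      from that obtain k l where "i = f k" "j = f l" "(k, l) \<in> \<Pi>" by auto
      then show ?thesis using tournament_on_asym[OF t] by (simp add: mem)
    qed
    fix i j assume "i \<in> f ` I" "j \<in> f ` I" "i \<noteq> j"
    then obtain k l where "i = f k" "j = f l" "k \<in> I" "l \<in> I" "k \<noteq> l" by blast
    then show "(i, j) \<in> map_prod f f ` \<Pi> \<or> (j, i) \<in> map_prod f f ` \<Pi>"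
      using tournament_on_total[OF t] mem by metis
  qed
  moreover have "card (f ` A) = card A" for A
    using f by (meson card_image inj_on_subset subset_UNIV)
  ultimately show ?thesis
    using g f unfolding game_on_def by (auto simp: outputs_map_prod inputs_map_prod)
qed

lemma card_Games_split_image_le:
  fixes f :: "'a \<Rightarrow> 'a"
  assumes f: "inj f"
  shows "card (Games_split z Ip Im) \<le> card (Games_split (f z) (f ` Ip) (f ` Im))"
proof (rule card_inj_on_le[OF _ _ finite_Games_split])
  show "inj_on ((`) (map_prod f f)) (Games_split z Ip Im)"
    using f by (meson inj_image_eq_iff inj_onI prod.inj_map)
  have "{f z} \<union> f ` Ip \<union> f ` Im = f ` ({z} \<union> Ip \<union> Im)" by auto
  then show "(`) (map_prod f f) ` Games_split z Ip Im \<subseteq> Games_split (f z) (f ` Ip) (f ` Im)"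
    using f game_on_map_prod[OF f]
    by (auto simp: Games_split_def Games_def outputs_map_prod inputs_map_prod simp del: image_insert)
qed

text \<open>Bijections between corresponding halves glue to a permutation \<open>f\<close> that
  fixes everything else, in particular \<open>z\<close>, and transports the games. An inequality
  suffices: the hypotheses are symmetric in the two splittings, so equality follows by exchanging
  them.\<close>

lemma card_Games_split_relabel_le:
  fixes z :: 'a
  assumes "z \<notin> Ip" "z \<notin> Im" and disj: "Ip \<inter> Im = {}" "Jp \<inter> Jm = {}"
    and "finite Ip" "finite Im" "finite Jp" "finite Jm" "card Ip = card Jp" "card Im = card Jm"
    and un: "Ip \<union> Im = Jp \<union> Jm"
  shows "card (Games_split z Ip Im) \<le> card (Games_split z Jp Jm)"
proof -
  obtain g h where g: "bij_betw g Ip Jp" and h: "bij_betw h Im Jm"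
    using assms by (meson finite_same_card_bij)
  define f where "f x = (if x \<in> Ip then g x else if x \<in> Im then h x else x)" for x
  have fp: "f ` Ip = Jp" using g by (simp add: f_def bij_betw_def)
  have "f ` Im = h ` Im" using disj by (intro image_cong) (auto simp: f_def)
  then have fm: "f ` Im = Jm" using h by (simp add: bij_betw_def)
  have "inj_on f Ip" using g by (simp add: f_def bij_betw_def inj_on_def)
  moreover have "inj_on f Im \<longleftrightarrow> inj_on h Im"
    using disj by (intro inj_on_cong) (auto simp: f_def)
  ultimately have "inj_on f (Ip \<union> Im)"
    using h fp fm disj unfolding inj_on_Un bij_betw_def by blast
  moreover have "f ` (Ip \<union> Im) = Ip \<union> Im" using image_Un[of f Ip Im] fp fm un by metis
  moreover have "f x = x" if "x \<notin> Ip \<union> Im" for x using that by (simp add: f_def)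
  \<comment> \<open>\<open>f\<close> maps \<open>Ip \<union> Im\<close> onto itself and fixes the
    complement, so no collision can occur between the two regions.\<close>
  ultimately have "inj f"
    unfolding inj_on_def by (metis image_eqI)
  moreover have "f z = z" using assms by (simp add: f_def)
  ultimately show ?thesis using card_Games_split_image_le[of f z Ip Im] fp fm by simp
qed

text \<open>Games are sorted by the output set \<open>A\<close> of \<open>z\<close>, an
  \<open>n\<close>-element subset of the other \<open>2 * n\<close> vertices; the inputs of
  \<open>z\<close> are then forced to be \<open>J - A\<close>. The classes are disjoint and, by
  relabelling in both directions, equally large.\<close>

lemma card_Games:
  fixes z :: 'a
  assumes z: "z \<notin> Ip" "z \<notin> Im" "Ip \<inter> Im = {}" and fin: "finite Ip" "finite Im"
    and cards: "card Ip = n" "card Im = n"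
  shows "card (Games ({z} \<union> Ip \<union> Im)) = ((2 * n) choose n) * card (Games_split z Ip Im)"
proof -
  define J where "J = Ip \<union> Im"
  define K where "K = {A. A \<subseteq> J \<and> card A = n}"
  have J: "finite J" "z \<notin> J" "card J = 2 * n"
    using z fin cards by (auto simp: J_def card_Un_disjoint)
  have cardI: "card (insert z J) = 2 * n + 1" using J by simp
  have A: "{z} \<union> (J - A) \<union> A = insert z J" "card (J - A) = n" "finite A" if "A \<in> K" for A
    using that J by (auto simp: K_def card_Diff_subset finite_subset)
  have un: "Games (insert z J) = (\<Union>A\<in>K. Games_split z (J - A) A)"
  proof (intro equalityI subsetI)
    fix \<Pi> assume \<Pi>: "\<Pi> \<in> Games (insert z J)"
    then have t: "tournament_on (insert z J) \<Pi>" and g: "game_on (insert z J) \<Pi>"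
      by (auto simp: Games_def game_on_def)
    have K: "outputs \<Pi> z \<in> K"
      using outputs_subset[OF t, of z] game_on_card_outputs[OF g cardI, of z] J by (simp add: K_def)
    moreover have "inputs \<Pi> z = J - outputs \<Pi> z"
      using inputs_tournament[OF t] J by auto
    ultimately show "\<Pi> \<in> (\<Union>A\<in>K. Games_split z (J - A) A)"
      using \<Pi> A(1)[OF K] by (auto simp: Games_split_def)
  next
    fix \<Pi> assume "\<Pi> \<in> (\<Union>A\<in>K. Games_split z (J - A) A)"
    then show "\<Pi> \<in> Games (insert z J)" using A(1) by (auto simp: Games_split_def)
  qed
  have "card (Games (insert z J)) = (\<Sum>A\<in>K. card (Games_split z (J - A) A))"
    unfolding un
  proof (rule card_UN_disjoint)
    show "finite K" using J by (simp add: K_def)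
    show "\<forall>A\<in>K. finite (Games_split z (J - A) A)" by (simp add: finite_Games_split)
  qed (auto simp: Games_split_def)
  also have "\<dots> = (\<Sum>A\<in>K. card (Games_split z Ip Im))"
  proof (rule sum.cong[OF refl])
    fix B assume B: "B \<in> K"
    then have B': "B \<subseteq> J" "card B = n" by (auto simp: K_def)
    have *: "J - B \<union> B = Ip \<union> Im" using B' by (auto simp: J_def)
    show "card (Games_split z (J - B) B) = card (Games_split z Ip Im)"
      by (intro antisym card_Games_split_relabel_le) (use A[OF B] B' * J z fin cards in auto)
  qed
  also have "\<dots> = ((2 * n) choose n) * card (Games_split z Ip Im)"
    using n_subsets[OF J(1), of n] J(3) by (simp add: K_def)
  finally show ?thesis by (simp add: J_def)
qed

theorem mainTheorem1:
  fixes n :: nat and z :: 'a and I Ip Im :: "'a set"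
  assumes "n \<ge> 1"
    and "I = {z} \<union> Ip \<union> Im"
    and "z \<notin> Ip" and "z \<notin> Im" and "Ip \<inter> Im = {}"
    and "finite Ip" and "finite Im"
    and "card Ip = n" and "card Im = n"
  shows "card (Games I) = ((2 * n) choose n) * card (Games_split z Ip Im) \<and>
         ((2 * n) choose n) * card (Games_split z Ip Im) \<ge> ((2 * n) choose n) * 2 ^ (n * (n - 1))"
  using card_Games[OF assms(3-9)] card_Games_split_ge[OF assms(3-9)] assms(2) by simp

end
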